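(* Let $\mathscr{V}$ be a complex normed space. For $x, y\in\mathscr{V}$ there exists $\lambda\in\mathbb{T}$ such that the following statements are equivalent: (i) $x\parallel y$. (ii) $x\perp_{BJ}(\|y\|x + \lambda \|x\|y)$. (iii) $y\perp_{BJ}(\|x\|y + \overline{\lambda}\, \|y\|x)$.
   Context: $\mathbb{T}=\{\alpha\in\mathbb{C}:|\alpha|=1\}$. In a normed space, $x\parallel y$ (norm-parallel) means that $\|x+\mu y\|=\|x\|+\|y\|$ for some $\mu\in\mathbb{T}$. Birkhoff--James orthogonality $x\perp_{BJ} y$ means $\|x\|\le\|x+\gamma y\|$ for all $\gamma\in\mathbb{C}$. *)

theory Defs
  imports "HOL-Analysis.Analysis"
begin

text \<open>
  A complex normed space is a real normed space whose scalar multiplication extends to \<open>\<complex>\<close>,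
  with the norm homogeneous for complex scalars. Completeness is not assumed. The underlying
  real structure supplies addition, the norm axioms and the norm topology; \<open>scaleR_scaleC\<close>
  says that its scalar multiplication is the restriction of the complex one.
\<close>

class complex_normed_vector = real_normed_vector +
  fixes scaleC :: "complex \<Rightarrow> 'a \<Rightarrow> 'a"  (infixr "*\<^sub>C" 75)
  assumes scaleC_add_right: "a *\<^sub>C (x + y) = a *\<^sub>C x + a *\<^sub>C y"
    and scaleC_add_left: "(a + b) *\<^sub>C x = a *\<^sub>C x + b *\<^sub>C x"
    and scaleC_scaleC: "a *\<^sub>C b *\<^sub>C x = (a * b) *\<^sub>C x"
    and scaleC_one: "1 *\<^sub>C x = x"
    and scaleR_scaleC: "r *\<^sub>R x = complex_of_real r *\<^sub>C x"
    and norm_scaleC: "norm (a *\<^sub>C x) = cmod a * norm x"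

instantiation complex :: complex_normed_vector
begin

definition scaleC_complex :: "complex \<Rightarrow> complex \<Rightarrow> complex"
  where "scaleC_complex a x = a * x"

instance
  by standard (simp_all add: scaleC_complex_def algebra_simps norm_mult scaleR_conv_of_real)

end

definition unit_circle :: "complex set"
  where "unit_circle = {\<alpha>. cmod \<alpha> = 1}"

definition norm_parallel :: "'a::complex_normed_vector \<Rightarrow> 'a \<Rightarrow> bool"  (infix "\<parallel>" 50)
  where "x \<parallel> y \<longleftrightarrow> (\<exists>\<mu>\<in>unit_circle. norm (x + \<mu> *\<^sub>C y) = norm x + norm y)"

definition birkhoff_james_orthogonal :: "'a::complex_normed_vector \<Rightarrow> 'a \<Rightarrow> bool"
    (infix "\<bottom>\<^sub>B\<^sub>J" 50)
  where "x \<bottom>\<^sub>B\<^sub>J y \<longleftrightarrow> (\<forall>\<gamma>::complex. norm x \<le> norm (x + \<gamma> *\<^sub>C y))"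

end

theory Submission
  imports Defs
begin

text \<open>
  For every \<open>\<kappa>\<close> of modulus one, condition (ii) says exactly that
  \<open>\<parallel>x - \<kappa>y\<parallel> = \<parallel>x\<parallel> + \<parallel>y\<parallel>\<close> (lemma \<open>birkhoff_james_iff_norm_additive\<close>). Applied with \<open>x\<close> and \<open>y\<close>
  exchanged, the same lemma turns (iii) into \<open>\<parallel>y - cnj \<kappa> x\<parallel> = \<parallel>y\<parallel> + \<parallel>x\<parallel>\<close>, which is the same
  equation after multiplication by \<open>-\<kappa>\<close>. So (ii) and (iii) are equivalent for every \<open>\<kappa>\<close>, and each
  implies that \<open>x\<close> and \<open>y\<close> are parallel; conversely, if \<open>\<mu>\<close> witnesses that \<open>x\<close> and \<open>y\<close> are
  parallel, then \<open>\<kappa> = -\<mu>\<close> works. If they are not parallel, all three conditions fail for every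
  \<open>\<kappa>\<close> of modulus one.

  If \<open>x\<close> is orthogonal to \<open>\<parallel>y\<parallel>x + \<kappa>\<parallel>x\<parallel>y\<close> and \<open>x\<close>, \<open>y\<close> are nonzero, the one coefficient
  \<open>\<gamma> = -1/(2\<parallel>y\<parallel>)\<close> already gives the norm equation: it replaces \<open>x\<close> by the midpoint of \<open>x\<close> and
  the multiple of \<open>-\<kappa>y\<close> that has the norm of \<open>x\<close>. Conversely, let \<open>\<parallel>u + v\<parallel> = \<parallel>u\<parallel> + \<parallel>v\<parallel>\<close>.
  The Hahn-Banach theorem would give a functional \<open>f\<close> of norm at most one with \<open>f u = \<parallel>u\<parallel>\<close> and
  \<open>f v = \<parallel>v\<parallel>\<close>; with \<open>u = x\<close> and \<open>v = -\<kappa>y\<close> it annihilates \<open>\<parallel>y\<parallel>x + \<kappa>\<parallel>x\<parallel>y\<close>, so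
  \<open>\<parallel>x + \<gamma>(\<parallel>y\<parallel>x + \<kappa>\<parallel>x\<parallel>y)\<parallel> \<ge> f x = \<parallel>x\<parallel>\<close>. What is used of \<open>f\<close> is only the bound
  \<open>\<parallel>\<alpha>u + \<beta>v\<parallel> \<ge> Re \<alpha> \<parallel>u\<parallel> + Re \<beta> \<parallel>v\<parallel>\<close>, and this has an elementary proof
  (lemma \<open>norm_lincomb_ge_Re\<close>).
\<close>

text \<open>
  If \<open>q \<le> p\<close>, then \<open>p(u + v)\<close> exceeds \<open>pu + qv\<close> by \<open>(p - q)v\<close>, so a loss in the triangle inequality
  for \<open>pu + qv\<close> would be a loss for \<open>p(u + v)\<close> too.
\<close>

lemma norm_add_scaleR_eq:
  fixes u v :: "'a::real_normed_vector"
  assumes uv: "norm (u + v) = norm u + norm v" and "0 \<le> p" "0 \<le> q"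
  shows "norm (p *\<^sub>R u + q *\<^sub>R v) = p * norm u + q * norm v"
proof (rule antisym)
  show "norm (p *\<^sub>R u + q *\<^sub>R v) \<le> p * norm u + q * norm v"
    using norm_triangle_ineq[of "p *\<^sub>R u" "q *\<^sub>R v"] assms by simp
  have ordered: "b * norm a + c * norm d \<le> norm (b *\<^sub>R a + c *\<^sub>R d)"
    if ad: "norm (a + d) = norm a + norm d" and bc: "0 \<le> c" "c \<le> b" for a d :: 'a and b c
  proof -
    have "b * (norm a + norm d) = norm (b *\<^sub>R (a + d))"
      using ad bc by simp
    also have "b *\<^sub>R (a + d) = (b *\<^sub>R a + c *\<^sub>R d) + (b - c) *\<^sub>R d"
      by (simp add: algebra_simps)
    also have "norm \<dots> \<le> norm (b *\<^sub>R a + c *\<^sub>R d) + (b - c) * norm d"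
      using norm_triangle_ineq[of "b *\<^sub>R a + c *\<^sub>R d" "(b - c) *\<^sub>R d"] bc by simp
    finally show ?thesis by (simp add: algebra_simps)
  qed
  show "p * norm u + q * norm v \<le> norm (p *\<^sub>R u + q *\<^sub>R v)"
    using ordered[of u v q p] ordered[of v u p q] assms
    by (cases "q \<le> p") (auto simp: add.commute)
qed

text \<open>
  Far out along the positive real axis only the real part of a displacement changes the modulus:
  the imaginary part enters quadratically and is damped by \<open>1/t\<close>.
\<close>

lemma tendsto_cmod_add_of_real_diff:
  "((\<lambda>t. cmod (of_real t + c) - t) \<longlongrightarrow> Re c) at_top"
proof (rule tendsto_sandwich)
  show "\<forall>\<^sub>F t in at_top. Re c \<le> cmod (of_real t + c) - t"
    using complex_Re_le_cmod[of "of_real _ + c"] by (auto simp: algebra_simps)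
  show "\<forall>\<^sub>F t in at_top. cmod (of_real t + c) - t \<le> Re c + (Im c)\<^sup>2 / (t + Re c)"
    using eventually_gt_at_top[of "- Re c"]
  proof eventually_elim
    case (elim t)
    define s where "s = t + Re c"
    have s: "s > 0" using elim by (simp add: s_def)
    \<comment> \<open>Completing the square.\<close>
    have "s\<^sup>2 + (Im c)\<^sup>2 \<le> (s + (Im c)\<^sup>2 / s)\<^sup>2"
      using s by (simp add: power2_sum)
    then have "cmod (of_real t + c) \<le> s + (Im c)\<^sup>2 / s"
      using s by (simp add: cmod_def s_def[symmetric] real_le_lsqrt)
    then show ?case by (simp add: s_def)
  qed
  have "((\<lambda>t. (Im c)\<^sup>2 / (t + Re c)) \<longlongrightarrow> 0) at_top"
    unfolding add.commute[of _ "Re c"]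
    by (intro tendsto_divide_0[OF tendsto_const] filterlim_at_top_imp_at_infinity
        filterlim_tendsto_add_at_top[OF tendsto_const] filterlim_ident)
  then show "((\<lambda>t. Re c + (Im c)\<^sup>2 / (t + Re c)) \<longlongrightarrow> Re c) at_top"
    using tendsto_add[OF tendsto_const] by fastforce
qed simp

lemma norm_scaleC_add_le: "norm (a *\<^sub>C u + b *\<^sub>C v) \<le> cmod a * norm u + cmod b * norm v"
  using norm_triangle_ineq[of "a *\<^sub>C u" "b *\<^sub>C v"] by (simp add: norm_scaleC)

text \<open>
  For nonnegative real coefficients the bound is an equality. Adding \<open>t(u + v)\<close> makes the real
  parts of the coefficients nonnegative at a cost of at most \<open>t(\<parallel>u\<parallel> + \<parallel>v\<parallel>)\<close>. Adding then the
  combination with the conjugate coefficients removes the imaginary parts, and by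
  \<open>tendsto_cmod_add_of_real_diff\<close> the norm of that conjugate combination is, as \<open>t\<close> grows, at most
  \<open>(t + Re \<alpha>)\<parallel>u\<parallel> + (t + Re \<beta>)\<parallel>v\<parallel>\<close> up to a vanishing error.
\<close>

lemma norm_lincomb_ge_Re:
  fixes u v :: "'a::complex_normed_vector"
  assumes uv: "norm (u + v) = norm u + norm v"
  shows "Re \<alpha> * norm u + Re \<beta> * norm v \<le> norm (\<alpha> *\<^sub>C u + \<beta> *\<^sub>C v)"
proof -
  let ?w = "\<alpha> *\<^sub>C u + \<beta> *\<^sub>C v"
  let ?d = "\<lambda>c t. cmod (of_real t + cnj c) - t"
  have "\<forall>\<^sub>F t in at_top.
      (2 * Re \<alpha> - ?d \<alpha> t) * norm u + (2 * Re \<beta> - ?d \<beta> t) * norm v \<le> norm ?w"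
    using eventually_ge_at_top[of "max 0 (max (- Re \<alpha>) (- Re \<beta>))"]
  proof eventually_elim
    case (elim t)
    let ?conj = "(of_real t + cnj \<alpha>) *\<^sub>C u + (of_real t + cnj \<beta>) *\<^sub>C v"
    have double: "\<And>c. of_real (2 * (t + Re c)) = c + of_real t + (of_real t + cnj c)"
      by (simp add: complex_eq_iff)
    have split: "(2 * (t + Re \<alpha>)) *\<^sub>R u + (2 * (t + Re \<beta>)) *\<^sub>R v = ?w + t *\<^sub>R (u + v) + ?conj"
      unfolding scaleR_scaleC double scaleC_add_left scaleC_add_right by (simp add: algebra_simps)
    have "2 * (t + Re \<alpha>) * norm u + 2 * (t + Re \<beta>) * norm v
        = norm ((2 * (t + Re \<alpha>)) *\<^sub>R u + (2 * (t + Re \<beta>)) *\<^sub>R v)"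
      using elim by (intro norm_add_scaleR_eq[OF uv, symmetric]) auto
    also have "\<dots> \<le> norm ?w + norm (t *\<^sub>R (u + v)) + norm ?conj"
      unfolding split by (meson norm_triangle_le norm_triangle_ineq add_right_mono)
    also have "\<dots> \<le> norm ?w + t * (norm u + norm v)
        + (cmod (of_real t + cnj \<alpha>) * norm u + cmod (of_real t + cnj \<beta>) * norm v)"
      using elim uv norm_scaleC_add_le by (intro add_mono) auto
    finally show ?case by (simp add: algebra_simps)
  qed
  moreover have "((\<lambda>t. (2 * Re \<alpha> - ?d \<alpha> t) * norm u + (2 * Re \<beta> - ?d \<beta> t) * norm v) \<longlongrightarrow>
      (2 * Re \<alpha> - Re (cnj \<alpha>)) * norm u + (2 * Re \<beta> - Re (cnj \<beta>)) * norm v) at_top"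
    by (intro tendsto_intros tendsto_cmod_add_of_real_diff)
  ultimately have "(2 * Re \<alpha> - Re (cnj \<alpha>)) * norm u + (2 * Re \<beta> - Re (cnj \<beta>)) * norm v \<le> norm ?w"
    by (intro tendsto_upperbound) auto
  then show ?thesis by simp
qed

text \<open>
  In terms of \<open>v = -\<kappa>y\<close>, orthogonality says that no combination \<open>(1 + \<gamma>\<parallel>y\<parallel>)x - \<gamma>\<parallel>x\<parallel>v\<close> is shorter
  than \<open>x\<close>. The \<open>\<gamma>\<close>-terms cancel in the lower bound of \<open>norm_lincomb_ge_Re\<close>, because \<open>\<parallel>v\<parallel> = \<parallel>y\<parallel>\<close>.
\<close>

lemma birkhoff_james_iff_norm_additive:
  fixes x y :: "'a::complex_normed_vector"
  assumes \<kappa>: "cmod \<kappa> = 1"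
  shows "x \<bottom>\<^sub>B\<^sub>J (norm y *\<^sub>R x + \<kappa> *\<^sub>C (norm x *\<^sub>R y))
    \<longleftrightarrow> norm (x + (- \<kappa>) *\<^sub>C y) = norm x + norm y"
proof -
  define v where "v = (- \<kappa>) *\<^sub>C y"
  have v: "norm v = norm y" using \<kappa> by (simp add: v_def norm_scaleC)
  have shift: "x + \<gamma> *\<^sub>C (norm y *\<^sub>R x + \<kappa> *\<^sub>C (norm x *\<^sub>R y))
      = (1 + \<gamma> * of_real (norm y)) *\<^sub>C x + (- \<gamma> * of_real (norm x)) *\<^sub>C v" for \<gamma>
    by (simp add: v_def scaleR_scaleC scaleC_add_left scaleC_add_right scaleC_scaleC scaleC_one
        mult_ac)
  have bj: "x \<bottom>\<^sub>B\<^sub>J (norm y *\<^sub>R x + \<kappa> *\<^sub>C (norm x *\<^sub>R y)) \<longleftrightarrow>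
      (\<forall>\<gamma>. norm x \<le> norm ((1 + \<gamma> * of_real (norm y)) *\<^sub>C x + (- \<gamma> * of_real (norm x)) *\<^sub>C v))"
    by (simp only: birkhoff_james_orthogonal_def shift)
  show ?thesis unfolding bj v_def[symmetric]
  proof
    assume *: "\<forall>\<gamma>. norm x \<le> norm ((1 + \<gamma> * of_real (norm y)) *\<^sub>C x + (- \<gamma> * of_real (norm x)) *\<^sub>C v)"
    show "norm (x + v) = norm x + norm y"
    proof (cases "x = 0 \<or> y = 0")
      case True
      then show ?thesis using v by auto
    next
      case False
      then have pos: "norm x > 0" "norm y > 0" by auto
      \<comment> \<open>Between unit vectors, norm additivity is a lower bound on the midpoint alone; it is
        then carried back to \<open>x\<close> and \<open>v\<close> by rescaling.\<close>
      define x' v' where "x' = (1 / norm x) *\<^sub>R x" and "v' = (1 / norm y) *\<^sub>R v"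
      have unit: "norm x' = 1" "norm v' = 1" using pos v by (auto simp: x'_def v'_def)
      have coeff: "1 + of_real (- 1 / (2 * norm y)) * of_real (norm y) = complex_of_real (1 / 2)"
        "- of_real (- 1 / (2 * norm y)) * of_real (norm x)
          = complex_of_real (norm x / (2 * norm y))"
        using pos by (auto simp: field_simps)
      have "norm x \<le> norm ((1 / 2) *\<^sub>R x + (norm x / (2 * norm y)) *\<^sub>R v)"
        using spec[OF *, of "of_real (- 1 / (2 * norm y))"] unfolding coeff scaleR_scaleC .
      also have "(1 / 2) *\<^sub>R x + (norm x / (2 * norm y)) *\<^sub>R v = (norm x / 2) *\<^sub>R (x' + v')"
        using pos by (simp add: x'_def v'_def scaleR_add_right)
      finally have "2 \<le> norm (x' + v')" using pos by simp
      then have "norm (x' + v') = norm x' + norm v'"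
        using norm_triangle_ineq[of x' v'] unit by simp
      from norm_add_scaleR_eq[OF this, of "norm x" "norm y"] pos show ?thesis
        by (simp add: unit) (simp add: x'_def v'_def)
    qed
  next
    assume "norm (x + v) = norm x + norm y"
    then have *: "norm (x + v) = norm x + norm v" by (simp add: v)
    show "\<forall>\<gamma>. norm x \<le> norm ((1 + \<gamma> * of_real (norm y)) *\<^sub>C x + (- \<gamma> * of_real (norm x)) *\<^sub>C v)"
    proof
      fix \<gamma> :: complex
      show "norm x \<le> norm ((1 + \<gamma> * of_real (norm y)) *\<^sub>C x + (- \<gamma> * of_real (norm x)) *\<^sub>C v)"
        using norm_lincomb_ge_Re[OF *, of "1 + \<gamma> * of_real (norm y)" "- \<gamma> * of_real (norm x)"] v
        by (simp add: algebra_simps)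
    qed
  qed
qed

theorem theorem2p4:
  fixes x y :: "'a::complex_normed_vector"
  shows "\<exists>\<kappa>\<in>unit_circle.
    (x \<parallel> y \<longleftrightarrow> x \<bottom>\<^sub>B\<^sub>J (norm y *\<^sub>R x + \<kappa> *\<^sub>C (norm x *\<^sub>R y))) \<and>
    (x \<bottom>\<^sub>B\<^sub>J (norm y *\<^sub>R x + \<kappa> *\<^sub>C (norm x *\<^sub>R y)) \<longleftrightarrow>
      y \<bottom>\<^sub>B\<^sub>J (norm x *\<^sub>R y + cnj \<kappa> *\<^sub>C (norm y *\<^sub>R x)))"
proof -
  have ii_iff_iii: "x \<bottom>\<^sub>B\<^sub>J (norm y *\<^sub>R x + \<kappa> *\<^sub>C (norm x *\<^sub>R y)) \<longleftrightarrow>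
      y \<bottom>\<^sub>B\<^sub>J (norm x *\<^sub>R y + cnj \<kappa> *\<^sub>C (norm y *\<^sub>R x))" if \<kappa>: "cmod \<kappa> = 1" for \<kappa>
  proof -
    have "\<kappa> * cnj \<kappa> = 1" using \<kappa> by (simp add: complex_norm_square[symmetric])
    then have "(- \<kappa>) *\<^sub>C (y + (- cnj \<kappa>) *\<^sub>C x) = x + (- \<kappa>) *\<^sub>C y"
      by (simp add: scaleC_add_right scaleC_scaleC scaleC_one)
    then have "norm (x + (- \<kappa>) *\<^sub>C y) = norm (y + (- cnj \<kappa>) *\<^sub>C x)"
      using norm_scaleC[of "- \<kappa>" "y + (- cnj \<kappa>) *\<^sub>C x"] \<kappa> by simp
    then show ?thesis
      using \<kappa> by (simp add: birkhoff_james_iff_norm_additive add.commute)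
  qed
  obtain \<mu> where \<mu>: "cmod \<mu> = 1" "x \<parallel> y \<longleftrightarrow> norm (x + \<mu> *\<^sub>C y) = norm x + norm y"
  proof (cases "x \<parallel> y")
    case True
    then show ?thesis using that by (auto simp: norm_parallel_def unit_circle_def)
  next
    case False
    then show ?thesis using that[of 1] by (auto simp: norm_parallel_def unit_circle_def)
  qed
  show ?thesis
  proof (intro bexI[of _ "- \<mu>"] conjI)
    show "x \<parallel> y \<longleftrightarrow> x \<bottom>\<^sub>B\<^sub>J (norm y *\<^sub>R x + (- \<mu>) *\<^sub>C (norm x *\<^sub>R y))"
      using \<mu> birkhoff_james_iff_norm_additive[of "- \<mu>" x y] by simp
  qed (use \<mu> ii_iff_iii[of "- \<mu>"] in \<open>auto simp: unit_circle_def\<close>)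
qed

end
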